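(* The mechanism OptSocCost, which maps each location profile $\mathbf x$ to the edge $(a^*,b^* )$ defined as follows, is group strategyproof and optimal for the social cost (i.e. $SC(a^*,b^*,\mathbf x)=\min_{(a,b)}SC(a,b,\mathbf x)$ over all edges, for every $\mathbf x$). Let $X_L$ be the set of all $x\in[0,o)$ with $|N_{1l}(x)\cup N_2|\cdot(1-k)<|N_{1r}(x)|\cdot(1+k)$; put $a^*=\sup X_L$ if $X_L\neq\emptyset$ and $a^*=0$ otherwise. Let $X_R$ be the set of all $x\in(o,1]$ with $|N_{2r}(x)\cup N_1|\cdot(1-k)<|N_{2l}(x)|\cdot(1+k)$; put $b^*=\inf X_R$ if $X_R\neq\emptyset$ and $b^*=1$ otherwise.
   Context: Setting. Fix a constant $k\in[0,1)$ and an obstacle $[o,o+L]$ with $o\in(0,1)$ and $0\le L<1-o$. Agents $N=\{1,\ldots,n\}$ have locations $x_i\in[0,o)\cup(o+L,1]$; $N_1=\{i: x_i<o\}$ and $N_2=\{i: x_i>o+L\}$. An edge is a pair $(a,b)$ with $a\in[0,o)$, $b\in(o+L,1]$. The cost of agent $i\in N_1$ is $cost(a,b,x_i)=|x_i-a|+k(b-a)+(1-b)$; the cost of agent $i\in N_2$ is $cost(a,b,x_i)=|x_i-b|+k(b-a)+a$. The social cost is $SC(a,b,\mathbf x)=\sum_{i\in N}cost(a,b,x_i)$. Notation. For $x\in[0,o)$: $N_{1l}(x)=\{i\in N_1: x_i\le x\}$, $N_{1r}(x)=\{i\in N_1: x_i>x\}$. For $x\in(o,1]$: $N_{2l}(x)=\{i\in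 N_2: x_i<x\}$, $N_{2r}(x)=\{i\in N_2: x_i\ge x\}$. A mechanism $f$ maps location profiles to edges. It is group strategyproof if for every nonempty $S\subseteq N$, every profile $\mathbf x$ and every joint misreport $\mathbf x_S'$ of the agents in $S$ (each agent reporting a location in its own region), there is $i\in S$ with $cost(f(\mathbf x),x_i)\le cost(f(\mathbf x_S',\mathbf x_{-S}),x_i)$. *)

theory Defs
  imports Complex_Main "HOL-Library.FuncSet"
begin

text \<open>
  Throughout, the obstacle is \<open>[ob, ob + L]\<close>; the letter \<open>o\<close> itself is reserved syntax
  for function composition. The agents are \<open>{1..n}\<close>.
\<close>

definition left_region :: "real \<Rightarrow> real set" where
  "left_region ob = {0..<ob}"

definition right_region :: "real \<Rightarrow> real \<Rightarrow> real set" where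
  "right_region ob L = {ob + L<..1}"

text \<open>Extensional functions, so that a profile is determined by the locations of the agents.\<close>

definition profiles :: "real \<Rightarrow> real \<Rightarrow> nat \<Rightarrow> (nat \<Rightarrow> real) set" where
  "profiles ob L n = {1..n} \<rightarrow>\<^sub>E (left_region ob \<union> right_region ob L)"

definition edges :: "real \<Rightarrow> real \<Rightarrow> (real \<times> real) set" where
  "edges ob L = left_region ob \<times> right_region ob L"

definition N1 :: "real \<Rightarrow> nat \<Rightarrow> (nat \<Rightarrow> real) \<Rightarrow> nat set" where
  "N1 ob n x = {i \<in> {1..n}. x i < ob}"

definition N2 :: "real \<Rightarrow> real \<Rightarrow> nat \<Rightarrow> (nat \<Rightarrow> real) \<Rightarrow> nat set" where
  "N2 ob L n x = {i \<in> {1..n}. x i > ob + L}"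

definition N1l :: "real \<Rightarrow> nat \<Rightarrow> (nat \<Rightarrow> real) \<Rightarrow> real \<Rightarrow> nat set" where
  "N1l ob n x t = {i \<in> N1 ob n x. x i \<le> t}"

definition N1r :: "real \<Rightarrow> nat \<Rightarrow> (nat \<Rightarrow> real) \<Rightarrow> real \<Rightarrow> nat set" where
  "N1r ob n x t = {i \<in> N1 ob n x. x i > t}"

definition N2l :: "real \<Rightarrow> real \<Rightarrow> nat \<Rightarrow> (nat \<Rightarrow> real) \<Rightarrow> real \<Rightarrow> nat set" where
  "N2l ob L n x t = {i \<in> N2 ob L n x. x i < t}"

definition N2r :: "real \<Rightarrow> real \<Rightarrow> nat \<Rightarrow> (nat \<Rightarrow> real) \<Rightarrow> real \<Rightarrow> nat set" where
  "N2r ob L n x t = {i \<in> N2 ob L n x. x i \<ge> t}"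

text \<open>
  The cost of an agent located at \<open>y\<close>. It is only used for \<open>y\<close> in one of the two regions,
  so the second branch is the case \<open>y > ob + L\<close>.
\<close>

definition cost :: "real \<Rightarrow> real \<Rightarrow> real \<times> real \<Rightarrow> real \<Rightarrow> real" where
  "cost k ob = (\<lambda>(a, b) y.
     if y < ob then \<bar>y - a\<bar> + k * (b - a) + (1 - b)
     else \<bar>y - b\<bar> + k * (b - a) + a)"

definition social_cost ::
  "real \<Rightarrow> real \<Rightarrow> nat \<Rightarrow> real \<times> real \<Rightarrow> (nat \<Rightarrow> real) \<Rightarrow> real" where
  "social_cost k ob n e x = (\<Sum>i\<in>{1..n}. cost k ob e (x i))"

definition is_mechanism ::
  "real \<Rightarrow> real \<Rightarrow> nat \<Rightarrow> ((nat \<Rightarrow> real) \<Rightarrow> real \<times> real) \<Rightarrow> bool" where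
  "is_mechanism ob L n f \<longleftrightarrow> (\<forall>x \<in> profiles ob L n. f x \<in> edges ob L)"

text \<open>
  Here \<open>x'\<close> is the whole profile after the joint misreport of the agents in \<open>S\<close>: it agrees
  with \<open>x\<close> outside \<open>S\<close>, and each agent in \<open>S\<close> reports a location in its own region.
  Costs are evaluated at the true locations.
\<close>

definition group_strategyproof ::
  "real \<Rightarrow> real \<Rightarrow> real \<Rightarrow> nat \<Rightarrow> ((nat \<Rightarrow> real) \<Rightarrow> real \<times> real) \<Rightarrow> bool" where
  "group_strategyproof k ob L n f \<longleftrightarrow>
     (\<forall>S x x'. S \<noteq> {} \<longrightarrow> S \<subseteq> {1..n} \<longrightarrow>
        x \<in> profiles ob L n \<longrightarrow> x' \<in> profiles ob L n \<longrightarrow>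
        (\<forall>i \<in> {1..n} - S. x' i = x i) \<longrightarrow>
        (\<forall>i \<in> S. x' i \<in> left_region ob \<longleftrightarrow> x i \<in> left_region ob) \<longrightarrow>
        (\<exists>i \<in> S. cost k ob (f x) (x i) \<le> cost k ob (f x') (x i)))"

definition social_cost_optimal ::
  "real \<Rightarrow> real \<Rightarrow> real \<Rightarrow> nat \<Rightarrow> ((nat \<Rightarrow> real) \<Rightarrow> real \<times> real) \<Rightarrow> bool" where
  "social_cost_optimal k ob L n f \<longleftrightarrow>
     (\<forall>x \<in> profiles ob L n. f x \<in> edges ob L \<and>
        (\<forall>e \<in> edges ob L. social_cost k ob n (f x) x \<le> social_cost k ob n e x))"

definition XL :: "real \<Rightarrow> real \<Rightarrow> real \<Rightarrow> nat \<Rightarrow> (nat \<Rightarrow> real) \<Rightarrow> real set" where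
  "XL k ob L n x = {t \<in> {0..<ob}.
     real (card (N1l ob n x t \<union> N2 ob L n x)) * (1 - k) < real (card (N1r ob n x t)) * (1 + k)}"

text \<open>The range of \<open>t\<close> starts at \<open>ob\<close>, not at \<open>ob + L\<close>.\<close>

definition XR :: "real \<Rightarrow> real \<Rightarrow> real \<Rightarrow> nat \<Rightarrow> (nat \<Rightarrow> real) \<Rightarrow> real set" where
  "XR k ob L n x = {t \<in> {ob<..1}.
     real (card (N2r ob L n x t \<union> N1 ob n x)) * (1 - k) < real (card (N2l ob L n x t)) * (1 + k)}"

definition OptSocCost ::
  "real \<Rightarrow> real \<Rightarrow> real \<Rightarrow> nat \<Rightarrow> (nat \<Rightarrow> real) \<Rightarrow> real \<times> real" where
  "OptSocCost k ob L n x =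
     (if XL k ob L n x \<noteq> {} then Sup (XL k ob L n x) else 0,
      if XR k ob L n x \<noteq> {} then Inf (XR k ob L n x) else 1)"

end

theory Submission
  imports Defs
begin

text \<open>
  Put \<open>\<theta> = n (1 - k)\<close>. The social cost splits into a function of \<open>a\<close> and a function of \<open>b\<close>, each
  convex and piecewise linear; the right slope in \<open>a\<close> at \<open>t\<close> is \<open>\<theta>\<close> minus twice the number of
  agents of \<open>N1\<close> to the right of \<open>t\<close>, so \<open>a\<close> is the least minimiser of the first part. The
  reflection \<open>z \<mapsto> 1 - z\<close> identifies \<open>b\<close> with the same construction applied to \<open>N2\<close>, with the
  same threshold.

  An endpoint moves only if an agent on the side opposite to the movement (or at the endpoint)
  misreports; if the other endpoint stays fixed, that agent loses. If \<open>a\<close> increases, that agent gains only if \<open>b\<close> increases too; but then the agent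
  responsible for the increase of \<open>b\<close> loses. If \<open>a\<close> decreases by \<open>\<alpha>\<close>, that agent gains only if
  \<open>b\<close> increases by some \<open>\<beta>\<close> with \<open>(1 + k) \<alpha> < (1 - k) \<beta>\<close>, whereas the agent responsible for the
  increase of \<open>b\<close> gains only if \<open>(1 + k) \<beta> < (1 - k) \<alpha>\<close>.
\<close>

section \<open>Peaks: one endpoint as a threshold rule on the half-line\<close>

definition excess :: "'i set \<Rightarrow> ('i \<Rightarrow> real) \<Rightarrow> real \<Rightarrow> real set" where
  "excess I y \<theta> = {t. 0 \<le> t \<and> \<theta> < 2 * real (card {i \<in> I. t < y i})}"

text \<open>For finite \<open>I\<close> and \<theta> \<ge> 0 this is an order statistic clamped at
  0: the m-th largest location with m = floor(\<theta>/2) + 1, or 0 if that is negative or there are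
  fewer than m agents.\<close>

definition peak :: "'i set \<Rightarrow> ('i \<Rightarrow> real) \<Rightarrow> real \<Rightarrow> real" where
  "peak I y \<theta> = (if excess I y \<theta> = {} then 0 else Sup (excess I y \<theta>))"

text \<open>Used with \<open>A\<close> the set of locations: a point \<open>t\<close> just left of
  \<open>p\<close> such that counting strictly beyond \<open>t\<close> amounts to counting from
  \<open>p\<close> on.\<close>

lemma finite_gap_left:
  fixes p s :: real
  assumes "finite A" "s < p"
  obtains t where "s \<le> t" "t < p" "\<And>z. z \<in> A \<Longrightarrow> z < p \<Longrightarrow> z \<le> t"
proof
  let ?B = "insert s {z \<in> A. z < p}"
  show "s \<le> Max ?B" "\<And>z. z \<in> A \<Longrightarrow> z < p \<Longrightarrow> z \<le> Max ?B"
    using assms by auto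
  show "Max ?B < p"
    using assms by (subst Max_less_iff) auto
qed

lemma excess_bounded:
  assumes "0 \<le> \<theta>" "t \<in> excess I y \<theta>"
  obtains i where "i \<in> I" "t < y i"
proof -
  have "card {i \<in> I. t < y i} > 0"
    using assms by (simp add: excess_def)
  then have "{i \<in> I. t < y i} \<noteq> {}"
    by (metis card.empty less_irrefl)
  then show thesis
    using that by auto
qed

lemma excess_bdd_above:
  assumes "finite I" "0 \<le> \<theta>"
  shows "bdd_above (excess I y \<theta>)"
proof (rule bdd_aboveI)
  fix t assume "t \<in> excess I y \<theta>"
  then obtain i where "i \<in> I" "t < y i"
    using excess_bounded assms(2) by metis
  then show "t \<le> Max (y ` I)"
    using assms(1) by (meson Max_ge finite_imageI imageI less_imp_le order_trans)
qed

lemma excess_downward_closed: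
  assumes "finite I" "s \<in> excess I y \<theta>" "0 \<le> t" "t \<le> s"
  shows "t \<in> excess I y \<theta>"
proof -
  have "card {i \<in> I. s < y i} \<le> card {i \<in> I. t < y i}"
    using assms by (intro card_mono) auto
  then show ?thesis
    using assms by (auto simp: excess_def)
qed

text \<open>The count is nonincreasing and right-continuous in \<open>t\<close>, so
  \<open>excess\<close> is the half-open interval from 0 to the peak and its supremum is not
  attained. This turns every comparison with the peak into a count.\<close>

lemma less_peak_iff:
  assumes "finite I" "0 \<le> \<theta>" "0 \<le> t"
  shows "t < peak I y \<theta> \<longleftrightarrow> \<theta> < 2 * real (card {i \<in> I. t < y i})"
proof
  assume less: "t < peak I y \<theta>"
  then have ne: "excess I y \<theta> \<noteq> {}"
    using assms(3) by (auto simp: peak_def split: if_splits)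
  then obtain s where "s \<in> excess I y \<theta>" "t < s"
    using less less_cSup_iff[OF ne excess_bdd_above[OF assms(1,2)]] by (auto simp: peak_def)
  then show "\<theta> < 2 * real (card {i \<in> I. t < y i})"
    using excess_downward_closed[OF assms(1), of s y \<theta> t] assms(3) by (simp add: excess_def)
next
  assume *: "\<theta> < 2 * real (card {i \<in> I. t < y i})"
  \<comment> \<open>The nearest location right of \<open>t\<close>. No location lies strictly
    between \<open>t\<close> and \<open>m\<close>, so their midpoint has the same count and is still
    in \<open>excess\<close>.\<close>
  define m where "m = Min (y ` {i \<in> I. t < y i})"
  have "t \<in> excess I y \<theta>"
    using * assms(3) by (simp add: excess_def)
  then have ne: "{i \<in> I. t < y i} \<noteq> {}"
    using excess_bounded[OF assms(2)] by blast
  have "t < m"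
    unfolding m_def using ne assms(1) by (subst Min_gr_iff) auto
  have le: "m \<le> y i" if "i \<in> I" "t < y i" for i
    unfolding m_def using that assms(1) by (intro Min_le) auto
  have "{i \<in> I. (t + m) / 2 < y i} = {i \<in> I. t < y i}"
    using \<open>t < m\<close> le by (force simp: field_simps)
  then have mem: "(t + m) / 2 \<in> excess I y \<theta>"
    using * assms(3) \<open>t < m\<close> by (simp add: excess_def)
  then have "(t + m) / 2 \<le> peak I y \<theta>"
    using cSup_upper[OF mem excess_bdd_above[OF assms(1,2)]] by (auto simp: peak_def)
  then show "t < peak I y \<theta>"
    using \<open>t < m\<close> by simp
qed

lemma peak_nonneg:
  assumes "finite I" "0 \<le> \<theta>"
  shows "0 \<le> peak I y \<theta>"
proof (cases "excess I y \<theta> = {}")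
  case False
  then obtain t where "t \<in> excess I y \<theta>" by blast
  moreover from this have "0 \<le> t" by (simp add: excess_def)
  ultimately show ?thesis
    using less_peak_iff[OF assms, of t y] by (simp add: excess_def)
qed (simp add: peak_def)

lemma peak_less:
  assumes "finite I" "0 \<le> \<theta>" "0 < c" "\<And>i. i \<in> I \<Longrightarrow> y i < c"
  shows "peak I y \<theta> < c"
proof (rule ccontr)
  assume "\<not> peak I y \<theta> < c"
  obtain t where t: "0 \<le> t" "t < c" "\<And>z. z \<in> y ` I \<Longrightarrow> z < c \<Longrightarrow> z \<le> t"
    using finite_gap_left[of "y ` I" 0 c] assms(1,3) by blast
  then have "{i \<in> I. t < y i} = {}"
    using assms(4) by force
  then have "card {i \<in> I. t < y i} = 0"
    by (simp only: card.empty)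
  then show False
    using less_peak_iff[OF assms(1,2) t(1), of y] t(2) assms(2) \<open>\<not> peak I y \<theta> < c\<close>
    by simp
qed

text \<open>Points just left of a positive peak still exceed the threshold, and there the agents
  sitting exactly at the peak are counted too.\<close>

lemma card_ge_peak:
  assumes "finite I" "0 \<le> \<theta>" "0 < peak I y \<theta>"
  shows "\<theta> < 2 * real (card {i \<in> I. peak I y \<theta> \<le> y i})"
proof -
  let ?p = "peak I y \<theta>"
  obtain t where t: "0 \<le> t" "t < ?p" "\<And>z. z \<in> y ` I \<Longrightarrow> z < ?p \<Longrightarrow> z \<le> t"
    using finite_gap_left[of "y ` I" 0 ?p] assms(1,3) by blast
  have "{i \<in> I. t < y i} = {i \<in> I. ?p \<le> y i}"
    using t(2,3) by force
  then show ?thesis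
    using less_peak_iff[OF assms(1,2) t(1), of y] t(2) by simp
qed

section \<open>Who can move a peak\<close>

lemma peak_increase:
  assumes "finite I" "0 \<le> \<theta>" "peak I y \<theta> < peak I y' \<theta>"
  obtains i where "i \<in> I" "y i \<le> peak I y \<theta>" "y' i \<noteq> y i"
proof -
  let ?p = "peak I y \<theta>"
  \<comment> \<open>At the old peak twice the count is at most \<theta> for \<open>y\<close> but
    above \<theta> for \<open>y'\<close>, so some agent crossed from the left.\<close>
  have "card {i \<in> I. ?p < y i} < card {i \<in> I. ?p < y' i}"
    using less_peak_iff[OF assms(1,2) peak_nonneg[OF assms(1,2)], of y y']
      less_peak_iff[OF assms(1,2) peak_nonneg[OF assms(1,2)], of y y] assms(3)
    by simp
  then have "\<not> {i \<in> I. ?p < y' i} \<subseteq> {i \<in> I. ?p < y i}"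
    using card_mono[of "{i \<in> I. ?p < y i}" "{i \<in> I. ?p < y' i}"] assms(1) by auto
  then show thesis
    using that by fastforce
qed

lemma peak_decrease:
  assumes "finite I" "0 \<le> \<theta>" "peak I y' \<theta> < peak I y \<theta>"
  obtains i where "i \<in> I" "peak I y \<theta> \<le> y i" "y' i \<noteq> y i"
proof -
  let ?p = "peak I y \<theta>" and ?p' = "peak I y' \<theta>"
  have nn: "0 \<le> ?p'"
    by (rule peak_nonneg[OF assms(1,2)])
  \<comment> \<open>More than \<theta>/2 agents were at or beyond the old peak, and at most
    \<theta>/2 now report beyond the new one, so one of the former has moved.\<close>
  have "card {i \<in> I. ?p' < y' i} < card {i \<in> I. ?p \<le> y i}"
    using less_peak_iff[OF assms(1,2) nn, of y'] card_ge_peak[OF assms(1,2), of y] nn assms(3)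
    by simp
  then have "\<not> {i \<in> I. ?p \<le> y i} \<subseteq> {i \<in> I. ?p' < y' i}"
    using card_mono[of "{i \<in> I. ?p' < y' i}" "{i \<in> I. ?p \<le> y i}"] assms(1) by auto
  then show thesis
    using that assms(3) by fastforce
qed

section \<open>Minimality of the peak\<close>

lemma sum_sign:
  assumes "finite I"
  shows "(\<Sum>i\<in>I. if P i then 1 else - 1 :: real) = 2 * real (card {i \<in> I. P i}) - real (card I)"
proof -
  have "(\<Sum>i\<in>I. if P i then 1 else - 1 :: real) = (\<Sum>i\<in>I. 2 * (if P i then 1 else 0) - 1)"
    by (intro sum.cong) auto
  also have "\<dots> = 2 * real (card {i \<in> I. P i}) - real (card I)"
    using assms by (simp add: sum_subtractf sum_distrib_left[symmetric] sum.If_cases Int_def)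
  finally show ?thesis .
qed

text \<open>The objective is convex in \<open>t\<close>, so its one-sided tangents at the peak
  suffice: the right slope, \<theta> minus twice the count beyond the peak, is nonnegative, and the
  left slope is nonpositive by \<open>card_ge_peak\<close>.\<close>

lemma peak_minimises:
  assumes "finite I" "0 \<le> \<theta>" "0 \<le> t"
  shows "(\<Sum>i\<in>I. \<bar>y i - peak I y \<theta>\<bar>) + peak I y \<theta> * (\<theta> - card I)
    \<le> (\<Sum>i\<in>I. \<bar>y i - t\<bar>) + t * (\<theta> - card I)"
proof (cases "peak I y \<theta> \<le> t")
  case True
  let ?p = "peak I y \<theta>"
  \<comment> \<open>Each distance lies above its right tangent at the peak.\<close>
  have "(\<Sum>i\<in>I. \<bar>y i - ?p\<bar> - (t - ?p) * (if ?p < y i then 1 else - 1)) \<le> (\<Sum>i\<in>I. \<bar>y i - t\<bar>)"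
    using True by (intro sum_mono) auto
  then have "(\<Sum>i\<in>I. \<bar>y i - ?p\<bar>) - (t - ?p) * (2 * real (card {i \<in> I. ?p < y i}) - card I)
      \<le> (\<Sum>i\<in>I. \<bar>y i - t\<bar>)"
    using assms(1) by (simp only: sum_subtractf sum_distrib_left[symmetric] sum_sign)
  moreover have "(t - ?p) * (2 * real (card {i \<in> I. ?p < y i})) \<le> (t - ?p) * \<theta>"
    using True less_peak_iff[OF assms(1,2) peak_nonneg[OF assms(1,2)], of y y]
    by (intro mult_left_mono) auto
  ultimately show ?thesis
    by (simp add: algebra_simps)
next
  case False
  let ?p = "peak I y \<theta>"
  have "(\<Sum>i\<in>I. \<bar>y i - ?p\<bar> + (?p - t) * (if ?p \<le> y i then 1 else - 1)) \<le> (\<Sum>i\<in>I. \<bar>y i - t\<bar>)"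
    using False by (intro sum_mono) auto
  then have "(\<Sum>i\<in>I. \<bar>y i - ?p\<bar>) + (?p - t) * (2 * real (card {i \<in> I. ?p \<le> y i}) - card I)
      \<le> (\<Sum>i\<in>I. \<bar>y i - t\<bar>)"
    using assms(1) by (simp only: sum.distrib sum_distrib_left[symmetric] sum_sign)
  moreover have "(?p - t) * \<theta> \<le> (?p - t) * (2 * real (card {i \<in> I. ?p \<le> y i}))"
    using False card_ge_peak[OF assms(1,2), of y] assms(3)
    by (intro mult_left_mono) auto
  ultimately show ?thesis
    by (simp add: algebra_simps)
qed

section \<open>The mechanism as a pair of peaks\<close>

lemma finite_N1 [simp]: "finite (N1 ob n x)"
  and finite_N2 [simp]: "finite (N2 ob L n x)"
  by (simp_all add: N1_def N2_def)

lemma profiles_partition: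
  assumes "x \<in> profiles ob L n" "0 \<le> L"
  shows "N1 ob n x \<union> N2 ob L n x = {1..n}" "N1 ob n x \<inter> N2 ob L n x = {}"
  using assms
  by (fastforce simp: profiles_def N1_def N2_def left_region_def right_region_def PiE_iff)+

lemma card_profiles:
  assumes "x \<in> profiles ob L n" "0 \<le> L"
  shows "card (N1 ob n x) + card (N2 ob L n x) = n"
  using card_Un_disjoint[of "N1 ob n x" "N2 ob L n x"] profiles_partition[OF assms] by simp

text \<open>Substituting |B| = n - |A| collects the coefficient of |A| to (1 - k) + (1 + k) = 2;
  hence both endpoints share one threshold.\<close>

lemma majority_iff:
  fixes k :: real
  assumes "A \<subseteq> {1..n}" "B = {1..n} - A"
  shows "real (card B) * (1 - k) < real (card A) * (1 + k) \<longleftrightarrow> real n * (1 - k) < 2 * real (card A)"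
proof -
  have "card A \<le> n"
    using card_mono[OF _ assms(1)] by simp
  then have "real n = real (card B) + real (card A)"
    using assms finite_subset[OF assms(1)] by (simp add: card_Diff_subset)
  then show ?thesis
    by (simp only:) (simp add: algebra_simps)
qed

lemma XL_eq_excess:
  assumes "x \<in> profiles ob L n" "0 \<le> L" "k < 1"
  shows "XL k ob L n x = excess (N1 ob n x) x (real n * (1 - k))"
proof -
  have "N1l ob n x t \<union> N2 ob L n x = {1..n} - N1r ob n x t" for t
    using profiles_partition[OF assms(1,2)] by (fastforce simp: N1l_def N1r_def)
  moreover have "N1r ob n x t \<subseteq> {1..n}" for t
    by (auto simp: N1r_def N1_def)
  ultimately have maj: "real (card (N1l ob n x t \<union> N2 ob L n x)) * (1 - k)
      < real (card (N1r ob n x t)) * (1 + k)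
      \<longleftrightarrow> real n * (1 - k) < 2 * real (card {i \<in> N1 ob n x. t < x i})" for t
    using majority_iff[of "N1r ob n x t" n] by (simp add: N1r_def)
  have "t < ob" if t: "t \<in> excess (N1 ob n x) x (real n * (1 - k))" for t
  proof -
    obtain i where "i \<in> N1 ob n x" "t < x i"
      using excess_bounded[OF _ t] assms(3) by auto
    then show ?thesis
      by (simp add: N1_def)
  qed
  then show ?thesis
    unfolding XL_def maj by (auto simp: excess_def)
qed

lemma XR_eq_excess:
  assumes "x \<in> profiles ob L n" "0 \<le> L" "k < 1"
  shows "XR k ob L n x = (\<lambda>u. 1 - u) ` excess (N2 ob L n x) (\<lambda>i. 1 - x i) (real n * (1 - k))"
proof -
  have "N2r ob L n x t \<union> N1 ob n x = {1..n} - N2l ob L n x t" for t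
    using profiles_partition[OF assms(1,2)] by (fastforce simp: N2l_def N2r_def)
  moreover have "N2l ob L n x t \<subseteq> {1..n}" for t
    by (auto simp: N2l_def N2_def)
  moreover have "N2l ob L n x t = {i \<in> N2 ob L n x. 1 - t < 1 - x i}" for t
    by (auto simp: N2l_def)
  ultimately have maj: "real (card (N2r ob L n x t \<union> N1 ob n x)) * (1 - k)
      < real (card (N2l ob L n x t)) * (1 + k)
      \<longleftrightarrow> real n * (1 - k) < 2 * real (card {i \<in> N2 ob L n x. 1 - t < 1 - x i})" for t
    using majority_iff[of "N2l ob L n x t" n] by metis
  \<comment> \<open>\<open>excess\<close> states no upper bound; an agent counted at
    \<open>u\<close> supplies it, since that agent lies right of the obstacle.\<close>
  have upper: "u < 1 - ob" if u: "u \<in> excess (N2 ob L n x) (\<lambda>i. 1 - x i) (real n * (1 - k))" for u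
  proof -
    obtain i where "i \<in> N2 ob L n x" "u < 1 - x i"
      using excess_bounded[OF _ u] assms(3) by auto
    then show ?thesis
      using assms(2) by (simp add: N2_def)
  qed
  have "t \<in> XR k ob L n x
      \<longleftrightarrow> 1 - t \<in> excess (N2 ob L n x) (\<lambda>i. 1 - x i) (real n * (1 - k))" for t
    unfolding XR_def mem_Collect_eq maj using upper[of "1 - t"] by (auto simp: excess_def)
  then show ?thesis
    by (force simp: image_iff)
qed

lemma Inf_reflect:
  fixes A :: "real set"
  assumes "A \<noteq> {}" "bdd_above A"
  shows "Inf ((\<lambda>u. 1 - u) ` A) = 1 - Sup A"
proof (rule cInf_eq_non_empty)
  show "1 - Sup A \<le> z" if "z \<in> (\<lambda>u. 1 - u) ` A" for z
    using that cSup_upper[OF _ assms(2)] by force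
  show "z \<le> 1 - Sup A" if "\<And>w. w \<in> (\<lambda>u. 1 - u) ` A \<Longrightarrow> z \<le> w" for z
    using cSup_least[OF assms(1), of "1 - z"] that by force
qed (use assms(1) in simp)

lemma OptSocCost_eq_peak:
  assumes "x \<in> profiles ob L n" "0 \<le> L" "k < 1"
  shows "OptSocCost k ob L n x =
    (peak (N1 ob n x) x (real n * (1 - k)), 1 - peak (N2 ob L n x) (\<lambda>i. 1 - x i) (real n * (1 - k)))"
  unfolding OptSocCost_def XL_eq_excess[OF assms] XR_eq_excess[OF assms] peak_def
  using assms(3) by (auto simp: Inf_reflect excess_bdd_above)

section \<open>Feasibility and optimality\<close>

lemma OptSocCost_in_edges:
  assumes "x \<in> profiles ob L n" "0 \<le> L" "k < 1" "0 < ob" "L < 1 - ob"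
  shows "OptSocCost k ob L n x \<in> edges ob L"
proof -
  let ?\<theta> = "real n * (1 - k)"
  have "0 \<le> ?\<theta>"
    using assms(3) by simp
  moreover from this have "peak (N1 ob n x) x ?\<theta> < ob"
    using assms(4) by (intro peak_less) (auto simp: N1_def)
  moreover from \<open>0 \<le> ?\<theta>\<close> have "peak (N2 ob L n x) (\<lambda>i. 1 - x i) ?\<theta> < 1 - ob - L"
    using assms(5) by (intro peak_less) (auto simp: N2_def)
  ultimately show ?thesis
    by (simp add: OptSocCost_eq_peak[OF assms(1-3)] edges_def left_region_def right_region_def
        peak_nonneg)
qed

text \<open>Writing k (b - a) as k - k (1 - b) - k a and using |N1| + |N2| = n separates the
  variables \<open>a\<close> and 1 - b into two instances of the objective in
  \<open>peak_minimises\<close>.\<close>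

lemma social_cost_split:
  assumes "x \<in> profiles ob L n" "0 \<le> L"
  shows "social_cost k ob n (a, b) x =
    ((\<Sum>i\<in>N1 ob n x. \<bar>x i - a\<bar>) + a * (real n * (1 - k) - card (N1 ob n x)))
    + ((\<Sum>i\<in>N2 ob L n x. \<bar>(1 - x i) - (1 - b)\<bar>) + (1 - b) * (real n * (1 - k) - card (N2 ob L n x)))
    + k * real n"
proof -
  have "social_cost k ob n (a, b) x =
      (\<Sum>i\<in>N1 ob n x. cost k ob (a, b) (x i)) + (\<Sum>i\<in>N2 ob L n x. cost k ob (a, b) (x i))"
    unfolding social_cost_def
    using profiles_partition[OF assms] by (metis finite_N1 finite_N2 sum.union_disjoint)
  moreover have "(\<Sum>i\<in>N1 ob n x. cost k ob (a, b) (x i)) =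
      (\<Sum>i\<in>N1 ob n x. \<bar>x i - a\<bar> + (k * (b - a) + (1 - b)))"
    by (intro sum.cong) (auto simp: cost_def N1_def)
  moreover have "(\<Sum>i\<in>N2 ob L n x. cost k ob (a, b) (x i)) =
      (\<Sum>i\<in>N2 ob L n x. \<bar>(1 - x i) - (1 - b)\<bar> + (k * (b - a) + a))"
    using assms(2) by (intro sum.cong) (auto simp: cost_def N2_def abs_minus_commute)
  moreover have "real n = real (card (N1 ob n x)) + real (card (N2 ob L n x))"
    using card_profiles[OF assms] by linarith
  ultimately show ?thesis
    by (simp only: sum.distrib sum_constant) (simp add: algebra_simps)
qed

lemma OptSocCost_optimal:
  assumes "x \<in> profiles ob L n" "0 \<le> L" "k < 1" "e \<in> edges ob L"
  shows "social_cost k ob n (OptSocCost k ob L n x) x \<le> social_cost k ob n e x"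
proof -
  obtain a b where e: "e = (a, b)" "0 \<le> a" "0 \<le> 1 - b"
    using assms(4) by (auto simp: edges_def left_region_def right_region_def)
  have "0 \<le> real n * (1 - k)"
    using assms(3) by simp
  then show ?thesis
    unfolding e(1) OptSocCost_eq_peak[OF assms(1-3)] social_cost_split[OF assms(1,2)]
    using peak_minimises[of "N1 ob n x" "real n * (1 - k)" a x]
      peak_minimises[of "N2 ob L n x" "real n * (1 - k)" "1 - b" "\<lambda>i. 1 - x i"] e(2,3)
    by simp
qed

section \<open>Group strategyproofness\<close>

lemma OptSocCost_group_strategyproof:
  assumes "0 \<le> k" "k < 1" "0 \<le> L"
  shows "group_strategyproof k ob L n (OptSocCost k ob L n)"
  unfolding group_strategyproof_def
proof (intro allI impI)
  fix S :: "nat set" and x x'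
  assume S: "S \<noteq> {}" "S \<subseteq> {1..n}"
    and x: "x \<in> profiles ob L n" and x': "x' \<in> profiles ob L n"
    and truthful: "\<forall>i \<in> {1..n} - S. x' i = x i"
    and region: "\<forall>i \<in> S. x' i \<in> left_region ob \<longleftrightarrow> x i \<in> left_region ob"
  define I J \<theta> where "I = N1 ob n x" and "J = N2 ob L n x" and "\<theta> = real n * (1 - k)"
  define a b where "a = peak I x \<theta>" and "b = 1 - peak J (\<lambda>i. 1 - x i) \<theta>"
  define a' b' where "a' = peak I x' \<theta>" and "b' = 1 - peak J (\<lambda>i. 1 - x' i) \<theta>"
  have "z i < ob \<longleftrightarrow> z i \<in> left_region ob" if "z \<in> profiles ob L n" "i \<in> {1..n}" for z i
    using that \<open>0 \<le> L\<close>
    by (fastforce simp: profiles_def left_region_def right_region_def PiE_iff)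
  \<comment> \<open>Misreports stay in their region, so both peaks are taken over the same
    \<open>I\<close> and \<open>J\<close> before and after.\<close>
  then have "x' i < ob \<longleftrightarrow> x i < ob" if "i \<in> {1..n}" for i
    using x x' region truthful that by (metis DiffI)
  then have I': "N1 ob n x' = I"
    by (auto simp: I_def N1_def)
  then have J': "N2 ob L n x' = J"
    using profiles_partition[OF x \<open>0 \<le> L\<close>] profiles_partition[OF x' \<open>0 \<le> L\<close>]
    unfolding I_def J_def by blast
  have opt: "OptSocCost k ob L n x = (a, b)" "OptSocCost k ob L n x' = (a', b')"
    using OptSocCost_eq_peak[OF x] OptSocCost_eq_peak[OF x'] assms I' J'
    by (simp_all add: a_def b_def a'_def b'_def I_def J_def \<theta>_def)
  have fin: "finite I" "finite J" "0 \<le> \<theta>"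
    using assms by (simp_all add: I_def J_def \<theta>_def)
  have IS: "i \<in> S" if "i \<in> I" "x' i \<noteq> x i" for i
    using that truthful by (auto simp: I_def N1_def)
  have JS: "i \<in> S" if "i \<in> J" "x' i \<noteq> x i" for i
    using that truthful by (auto simp: J_def N2_def)
  show "\<exists>i\<in>S. cost k ob (OptSocCost k ob L n x) (x i) \<le> cost k ob (OptSocCost k ob L n x') (x i)"
  proof (rule ccontr)
    assume "\<not> ?thesis"
    then have gain: "cost k ob (a', b') (x i) < cost k ob (a, b) (x i)" if "i \<in> S" for i
      using that by (auto simp: opt not_le)
    have gain1: "\<bar>x i - a'\<bar> + k * (b' - a') - b' < \<bar>x i - a\<bar> + k * (b - a) - b"
      if "i \<in> I" "x' i \<noteq> x i" for i
      using gain[OF IS[OF that]] that by (simp add: cost_def I_def N1_def)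
    have gain2: "\<bar>x i - b'\<bar> + k * (b' - a') + a' < \<bar>x i - b\<bar> + k * (b - a) + a"
      if "i \<in> J" "x' i \<noteq> x i" for i
      using gain[OF JS[OF that]] that \<open>0 \<le> L\<close> by (simp add: cost_def J_def N2_def)
    \<comment> \<open>In reflected coordinates a rise of \<open>b\<close> is a decrease of the peak.
      The agent found lies at or left of \<open>b\<close>, so its distance grows by the full b' -
      b.\<close>
    have b_up: "(1 + k) * (b' - b) < (1 - k) * (a - a')" if less: "b < b'"
    proof -
      obtain i where "i \<in> J" "x i \<le> b" "x' i \<noteq> x i"
        using peak_decrease[OF fin(2,3), of "\<lambda>i. 1 - x' i" "\<lambda>i. 1 - x i"] less
        by (force simp: b_def b'_def)
      then show ?thesis
        using gain2[of i] less by (simp add: algebra_simps)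
    qed
    have b_down: "(1 - k) * (b - b') < (1 - k) * (a - a')" if less: "b' < b"
    proof -
      obtain i where "i \<in> J" "b \<le> x i" "x' i \<noteq> x i"
        using peak_increase[OF fin(2,3), of "\<lambda>i. 1 - x i" "\<lambda>i. 1 - x' i"] less
        by (force simp: b_def b'_def)
      then show ?thesis
        using gain2[of i] less by (simp add: algebra_simps)
    qed
    have a_up: "(1 - k) * (a' - a) < (1 - k) * (b' - b)" if less: "a < a'"
    proof -
      obtain i where "i \<in> I" "x i \<le> a" "x' i \<noteq> x i"
        using peak_increase[OF fin(1,3), of x x'] less by (auto simp: a_def a'_def)
      then show ?thesis
        using gain1[of i] less by (simp add: algebra_simps)
    qed
    have a_down: "(1 + k) * (a - a') < (1 - k) * (b' - b)" if less: "a' < a"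
    proof -
      obtain i where "i \<in> I" "a \<le> x i" "x' i \<noteq> x i"
        using peak_decrease[OF fin(1,3), of x' x] less by (auto simp: a_def a'_def)
      then show ?thesis
        using gain1[of i] less by (simp add: algebra_simps)
    qed
    \<comment> \<open>Lowering 1 + k to 1 - k on nonnegative differences makes the four bounds
      comparable; \<open>cancel\<close> then divides by 1 - k > 0.\<close>
    have mono: "(1 - k) * u \<le> (1 + k) * u" if "0 \<le> u" for u
      using that \<open>0 \<le> k\<close> by (intro mult_right_mono) auto
    have cancel: "u < v" if "(1 - k) * u < (1 - k) * v" for u v
      using that \<open>k < 1\<close> by simp
    consider "a < a'" | "a' < a" | "a = a'" "b < b'" | "a = a'" "b' < b" | "a = a'" "b = b'"
      by linarith
    then show False
    proof cases
      case 1
      then have "b < b'"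
        using cancel[OF a_up] by simp
      then show False
        using cancel[OF le_less_trans[OF mono b_up]] 1 by simp
    next
      case 2
      then have "a - a' < b' - b"
        using cancel[OF le_less_trans[OF mono a_down]] by simp
      moreover from this 2 have "b' - b < a - a'"
        using cancel[OF le_less_trans[OF mono b_up]] by simp
      ultimately show False
        by simp
    next
      case 3
      then show False
        using cancel[OF le_less_trans[OF mono b_up]] by simp
    next
      case 4
      then show False
        using cancel[OF b_down] by simp
    next
      case 5
      then show False
        \<comment> \<open>The edge is unchanged, so a strict gain for any member of the nonempty
          \<open>S\<close> is absurd.\<close>
        using gain S(1) by auto
    qed
  qed
qed

theorem theorem2:
  fixes k ob L :: real and n :: nat
  assumes "0 \<le> k" and "k < 1"
    and "0 < ob" and "ob < 1"
    and "0 \<le> L" and "L < 1 - ob"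
  shows "is_mechanism ob L n (OptSocCost k ob L n) \<and>
    group_strategyproof k ob L n (OptSocCost k ob L n) \<and>
    social_cost_optimal k ob L n (OptSocCost k ob L n)"
  using assms OptSocCost_in_edges OptSocCost_optimal OptSocCost_group_strategyproof
  by (simp add: is_mechanism_def social_cost_optimal_def)

end
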